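(* Let $k$ be a field, let $S$ be a finitely generated commutative $k$-algebra, and let $G$ be a finite subgroup of the group of $k$-algebra automorphisms of $S$. Then the $G$-cofixed space $S_G$ is a finitely generated module over the $G$-fixed subalgebra $S^G$.
   Context: The $G$-cofixed space is $S_G=S/N$, where $N$ is the $k$-linear span of all elements $g(s)-s$ with $g\in G$, $s\in S$; $N$ is an $S^G$-submodule of $S$, so $S_G$ is a quotient $S^G$-module of $S$. *)

theory Defs
  imports "HOL-Algebra.Algebra"
begin

definition module_span ::
    "('a, 'm) ring_scheme \<Rightarrow> ('a, 'b, 'n) module_scheme \<Rightarrow> 'b set \<Rightarrow> 'b set"
  where "module_span R M A = (\<lambda>H. submodule H R M) hull A"

definition fin_gen_module ::
    "('a, 'm) ring_scheme \<Rightarrow> ('a, 'b, 'n) module_scheme \<Rightarrow> bool"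
  where "fin_gen_module R M \<longleftrightarrow>
    module R M \<and> (\<exists>A. finite A \<and> A \<subseteq> carrier M \<and> module_span R M A = carrier M)"

definition alg_span ::
    "('a, 'm) ring_scheme \<Rightarrow> ('a, 'b, 'n) module_scheme \<Rightarrow> 'b set \<Rightarrow> 'b set"
  where "alg_span R S A = (\<lambda>H. subring H S \<and> submodule H R S) hull A"

text \<open>The locale \<^locale>\<open>algebra\<close> already makes the algebra commutative, associative and unital;
  the zero ring is allowed.\<close>

definition fin_gen_algebra ::
    "('a, 'm) ring_scheme \<Rightarrow> ('a, 'b, 'n) module_scheme \<Rightarrow> bool"
  where "fin_gen_algebra R S \<longleftrightarrow>
    algebra R S \<and> (\<exists>A. finite A \<and> A \<subseteq> carrier S \<and> alg_span R S A = carrier S)"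

text \<open>As for \<^const>\<open>AutoGroup\<close>, automorphisms are extensional functions, so that each
  automorphism of the carrier is represented by exactly one function.\<close>

definition alg_auto ::
    "('a, 'm) ring_scheme \<Rightarrow> ('a, 'b, 'n) module_scheme \<Rightarrow> ('b \<Rightarrow> 'b) set"
  where "alg_auto R S = {f \<in> ring_hom S S \<inter> Bij (carrier S).
    \<forall>a\<in>carrier R. \<forall>s\<in>carrier S. f (a \<odot>\<^bsub>S\<^esub> s) = a \<odot>\<^bsub>S\<^esub> f s}"

definition AlgAutoGroup ::
    "('a, 'm) ring_scheme \<Rightarrow> ('a, 'b, 'n) module_scheme \<Rightarrow> ('b \<Rightarrow> 'b) monoid"
  where "AlgAutoGroup R S = BijGroup (carrier S) \<lparr>carrier := alg_auto R S\<rparr>"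

definition fixed_subalgebra ::
    "('a, 'b, 'n) module_scheme \<Rightarrow> ('b \<Rightarrow> 'b) set \<Rightarrow> ('a, 'b, 'n) module_scheme"
  where "fixed_subalgebra S G = S \<lparr>carrier := {s \<in> carrier S. \<forall>g\<in>G. g s = s}\<rparr>"

text \<open>A ring with scalars acting by the ring's own multiplication; restricting the scalars to
  a subring \<open>T\<close> turns it into a \<open>T\<close>-module.\<close>

definition mult_module :: "('b, 'n) ring_scheme \<Rightarrow> ('b, 'b) module"
  where "mult_module S =
    \<lparr>carrier = carrier S, monoid.mult = monoid.mult S, one = \<one>\<^bsub>S\<^esub>,
     ring.zero = \<zero>\<^bsub>S\<^esub>, add = add S, smult = monoid.mult S\<rparr>"

text \<open>The additive cosets of \<open>N\<close>. The fields \<^const>\<open>monoid.mult\<close> and \<^const>\<open>one\<close> are forced by the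
  record type and play no role for a module.\<close>

definition quotient_module :: "('a, 'b, 'n) module_scheme \<Rightarrow> 'b set \<Rightarrow> ('a, 'b set) module"
  where "quotient_module M N =
    \<lparr>carrier = a_rcosets\<^bsub>M\<^esub> N, monoid.mult = undefined, one = undefined,
     ring.zero = N, add = set_add M,
     smult = (\<lambda>a C. \<Union>x\<in>C. N +>\<^bsub>M\<^esub> (a \<odot>\<^bsub>M\<^esub> x))\<rparr>"

definition cofixed_kernel ::
    "('a, 'm) ring_scheme \<Rightarrow> ('a, 'b, 'n) module_scheme \<Rightarrow> ('b \<Rightarrow> 'b) set \<Rightarrow> 'b set"
  where "cofixed_kernel k S G =
    module_span k S {g s \<ominus>\<^bsub>S\<^esub> s | g s. g \<in> G \<and> s \<in> carrier S}"

text \<open>\<open>N = cofixed_kernel k S G\<close> is spanned over \<open>k\<close>, whereas the scalars of the quotient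
  \<open>S / N\<close> are elements of \<open>S\<close>, acting by multiplication. The set \<open>N\<close> need not be an
  ideal of \<open>S\<close>, but it is stable under the scalars in \<^term>\<open>fixed_subalgebra S G\<close>.\<close>

definition cofixed_space ::
    "('a, 'm) ring_scheme \<Rightarrow> ('a, 'b, 'n) module_scheme \<Rightarrow> ('b \<Rightarrow> 'b) set \<Rightarrow> ('b, 'b set) module"
  where "cofixed_space k S G = quotient_module (mult_module S) (cofixed_kernel k S G)"

end

theory Submission
  imports Defs
begin

text \<open>Every \<open>a \<in> S\<close> is a root of the monic polynomial \<open>\<Prod>g\<in>G. (X - g a)\<close>, whose coefficients are
  up to sign the elementary symmetric functions of the orbit of \<open>a\<close> and hence \<open>G\<close>-fixed. So \<open>S\<close> is
  integral over \<open>S\<^sup>G\<close>; being finitely generated as an algebra, it is a finitely generated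
  \<open>S\<^sup>G\<close>-module, and so is its quotient \<open>S\<^sub>G\<close>.\<close>

section \<open>Spans, and a ring as a module over a subring\<close>

lemma (in module) submodule_Inter:
  assumes "\<And>H. H \<in> \<H> \<Longrightarrow> submodule H R M" and "\<H> \<noteq> {}"
  shows "submodule (\<Inter>\<H>) R M"
proof (intro submodule.intro submodule_axioms.intro)
  show "subgroup (\<Inter>\<H>) (add_monoid M)"
    using assms by (intro M.add.subgroups_Inter) (auto dest: submodule.axioms(1))
  show "a \<odot>\<^bsub>M\<^esub> x \<in> \<Inter>\<H>" if "a \<in> carrier R" "x \<in> \<Inter>\<H>" for a x
    using that assms by (auto dest: submodule.smult_closed)
qed

lemma (in module) submodule_module_span:
  assumes "A \<subseteq> carrier M"
  shows "submodule (module_span R M A) R M"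
  unfolding module_span_def hull_def
  using assms carrier_is_submodule by (intro submodule_Inter) auto

lemma module_span_superset: "A \<subseteq> module_span R M A"
  unfolding module_span_def by (rule hull_subset)

lemma module_span_base: "x \<in> A \<Longrightarrow> x \<in> module_span R M A"
  using module_span_superset by (rule subsetD)

lemma module_span_minimal: "A \<subseteq> H \<Longrightarrow> submodule H R M \<Longrightarrow> module_span R M A \<subseteq> H"
  unfolding module_span_def by (rule hull_minimal)

text \<open>The additive groups of \<open>mult_module R\<close> and of \<open>R\<close> are
  different records with the same operations, so inverses are compared by unfolding
  \<open>m_inv_def\<close>. This translates submodules into conditions on \<open>R\<close> alone,
  with an arbitrary set \<open>K\<close> of scalars.\<close>

lemma submodule_mult_module_iff:
  "submodule H (R\<lparr>carrier := K\<rparr>) (mult_module R) \<longleftrightarrow>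
    subgroup H (add_monoid R) \<and> (\<forall>a\<in>K. \<forall>x\<in>H. a \<otimes>\<^bsub>R\<^esub> x \<in> H)"
  by (auto simp: submodule_def submodule_axioms_def subgroup_def mult_module_def m_inv_def)

text \<open>Closure under negation comes for free: the subring \<open>K\<close> contains
  \<open>-1\<close>, and \<open>-x = (-1) x\<close>.\<close>

lemma (in cring) submodule_mult_moduleI:
  assumes "H \<subseteq> carrier R" "\<zero> \<in> H" "\<And>x y. x \<in> H \<Longrightarrow> y \<in> H \<Longrightarrow> x \<oplus> y \<in> H"
    and "\<And>a x. a \<in> K \<Longrightarrow> x \<in> H \<Longrightarrow> a \<otimes> x \<in> H" and K: "subring K R"
  shows "submodule H (R\<lparr>carrier := K\<rparr>) (mult_module R)"
proof -
  have "\<ominus> x \<in> H" if "x \<in> H" for x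
  proof -
    have "(\<ominus> \<one>) \<otimes> x \<in> H"
      using assms(4) subringE(3,5)[OF K] that by blast
    then show ?thesis
      using that assms(1) by (simp add: l_minus subset_iff)
  qed
  then have "subgroup H (add_monoid R)"
    using assms(1-3) by (intro subgroup.intro) (auto simp: a_inv_def)
  then show ?thesis
    using assms(4) by (simp add: submodule_mult_module_iff)
qed

lemma (in cring) submodule_mult_moduleE:
  assumes "submodule H (R\<lparr>carrier := K\<rparr>) (mult_module R)"
  shows "H \<subseteq> carrier R" "\<zero> \<in> H" "\<And>x y. x \<in> H \<Longrightarrow> y \<in> H \<Longrightarrow> x \<oplus> y \<in> H"
    "\<And>x. x \<in> H \<Longrightarrow> \<ominus> x \<in> H"
    "\<And>a x. a \<in> K \<Longrightarrow> x \<in> H \<Longrightarrow> a \<otimes> x \<in> H"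
  using assms subgroup.subset[of H "add_monoid R"] subgroup.one_closed[of H "add_monoid R"]
    subgroup.m_closed[of H "add_monoid R"] subgroup.m_inv_closed[of H "add_monoid R"]
  by (auto simp: submodule_mult_module_iff a_inv_def)

lemma (in cring) module_mult_module:
  assumes "subring K R"
  shows "module (R\<lparr>carrier := K\<rparr>) (mult_module R)"
proof (rule moduleI)
  show "cring (R\<lparr>carrier := K\<rparr>)"
    using assms subcring_iff subcringI' subringE(1) by metis
  show "abelian_group (mult_module R)"
    by (rule abelian_groupI)
      (auto simp: mult_module_def a_ac intro: bexI[of _ "\<ominus> _"] l_neg)
qed (use subringE(1)[OF assms] in \<open>auto simp: mult_module_def subset_iff l_distr r_distr m_assoc\<close>)

section \<open>Elementary symmetric functions and the expansion of a product of linear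
  factors\<close>

text \<open>Induction on \<open>I\<close>. The subsets of \<open>insert i I\<close> split into those
  avoiding \<open>i\<close>, whose terms gain a factor \<open>x\<close>, and those containing
  \<open>i\<close>, whose terms gain a factor \<open>b i\<close>.\<close>

lemma (in cring) finprod_add_expand:
  assumes "finite I" "x \<in> carrier R" "b \<in> I \<rightarrow> carrier R"
  shows "(\<Otimes>i\<in>I. x \<oplus> b i) = (\<Oplus>T\<in>Pow I. (\<Otimes>i\<in>T. b i) \<otimes> x [^] card (I - T))"
  using assms
proof (induction I rule: finite_induct)
  case empty
  then show ?case by simp
next
  case (insert i I)
  let ?f = "\<lambda>J T. (\<Otimes>i\<in>T. b i) \<otimes> x [^] card (J - T)"
  have b: "b i \<in> carrier R" "b \<in> I \<rightarrow> carrier R"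
    using insert.prems by auto
  have bT: "(\<Otimes>i\<in>T. b i) \<in> carrier R" if "T \<subseteq> I" for T
    using that b by (intro finprod_closed) auto
  have inj: "inj_on (insert i) (Pow I)"
    using insert.hyps by (auto simp: inj_on_def)
  have bi: "(\<Otimes>j\<in>insert i T. b j) = b i \<otimes> (\<Otimes>j\<in>T. b j)" if "T \<subseteq> I" for T
    using that b insert.hyps finite_subset[OF that] by (subst finprod_insert) auto
  have f1: "?f (insert i I) T = ?f I T \<otimes> x" if "T \<subseteq> I" for T
  proof -
    have "insert i I - T = insert i (I - T)" "i \<notin> I - T" "finite (I - T)"
      using that insert.hyps by auto
    then show ?thesis
      using bT[OF that] insert.prems by (simp add: m_assoc)
  qed
  have f2: "?f (insert i I) (insert i T) = ?f I T \<otimes> b i" if "T \<subseteq> I" for T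
  proof -
    have "insert i I - insert i T = I - T"
      using that insert.hyps by auto
    then show ?thesis
      using bT[OF that] insert.prems b by (simp add: bi[OF that] m_ac)
  qed
  have fc: "?f J T \<in> carrier R" if "T \<subseteq> I" for T J
    using bT[OF that] insert.prems by simp
  have fc2: "?f J (insert i T) \<in> carrier R" if "T \<subseteq> I" for T J
    using bT[OF that] insert.prems b by (simp add: bi[OF that])
  have "(\<Oplus>T\<in>Pow (insert i I). ?f (insert i I) T) =
      (\<Oplus>T\<in>Pow I. ?f (insert i I) T) \<oplus> (\<Oplus>T\<in>insert i ` Pow I. ?f (insert i I) T)"
    unfolding Pow_insert using insert.hyps fc fc2
    by (intro finsum_Un_disjoint) auto
  also have "(\<Oplus>T\<in>insert i ` Pow I. ?f (insert i I) T) =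
      (\<Oplus>T\<in>Pow I. ?f (insert i I) (insert i T))"
    using fc2 inj by (intro finsum_reindex) auto
  also have "\<dots> = (\<Oplus>T\<in>Pow I. ?f I T \<otimes> b i)"
    using f2 fc b by (intro finsum_cong') auto
  also have "\<dots> = (\<Oplus>T\<in>Pow I. ?f I T) \<otimes> b i"
    using insert.hyps fc b by (intro finsum_ldistr[symmetric]) auto
  also have "(\<Oplus>T\<in>Pow I. ?f (insert i I) T) = (\<Oplus>T\<in>Pow I. ?f I T \<otimes> x)"
    using f1 fc insert.prems by (intro finsum_cong') auto
  also have "\<dots> = (\<Oplus>T\<in>Pow I. ?f I T) \<otimes> x"
    using insert.hyps fc insert.prems by (intro finsum_ldistr[symmetric]) auto
  also have "(\<Oplus>T\<in>Pow I. ?f I T) \<otimes> x \<oplus> (\<Oplus>T\<in>Pow I. ?f I T) \<otimes> b i =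
      (x \<oplus> b i) \<otimes> (\<Oplus>T\<in>Pow I. ?f I T)"
    using fc b insert.prems by (subst r_distr[symmetric]) (auto simp: m_comm intro!: finsum_closed)
  also have "\<dots> = (x \<oplus> b i) \<otimes> (\<Otimes>i\<in>I. x \<oplus> b i)"
    using insert by auto
  also have "\<dots> = (\<Otimes>i\<in>insert i I. x \<oplus> b i)"
    using insert by (subst finprod_insert) (auto simp: Pi_iff)
  finally show ?case ..
qed

text \<open>Subsets of the index set are summed over, not sets of values, so values that coincide
  count with multiplicity. For an orbit this matters when several group elements agree at a
  point.\<close>

definition (in cring) elem_sym :: "('i \<Rightarrow> 'a) \<Rightarrow> 'i set \<Rightarrow> nat \<Rightarrow> 'a"
  where "elem_sym b I j = (\<Oplus>T\<in>{T. T \<subseteq> I \<and> card T = j}. \<Otimes>i\<in>T. b i)"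

lemma (in cring) elem_sym_closed:
  "b \<in> I \<rightarrow> carrier R \<Longrightarrow> elem_sym b I j \<in> carrier R"
  unfolding elem_sym_def by (auto intro!: finsum_closed finprod_closed)

lemma (in cring) elem_sym_0: "finite I \<Longrightarrow> elem_sym b I 0 = \<one>"
proof -
  assume "finite I"
  \<comment> \<open>Infinite sets also have \<open>card\<close> equal to 0; finiteness of
    \<open>I\<close> excludes them.\<close>
  then have "{T. T \<subseteq> I \<and> card T = 0} = {{}}"
    by (auto simp: finite_subset card_eq_0_iff)
  then show ?thesis
    by (simp add: elem_sym_def)
qed

text \<open>Vieta's formula: the exponent of \<open>x\<close> in \<open>finprod_add_expand\<close>
  depends only on the cardinality of \<open>T\<close>, so the subsets are grouped by
  cardinality.\<close>

lemma (in cring) finprod_add_eq_elem_sym: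
  assumes "finite I" "x \<in> carrier R" "b \<in> I \<rightarrow> carrier R"
  shows "(\<Otimes>i\<in>I. x \<oplus> b i) = (\<Oplus>j\<in>{..card I}. elem_sym b I j \<otimes> x [^] (card I - j))"
proof -
  let ?P = "\<lambda>j. {T. T \<subseteq> I \<and> card T = j}"
  let ?f = "\<lambda>T. (\<Otimes>i\<in>T. b i) \<otimes> x [^] card (I - T)"
  have bT: "(\<Otimes>i\<in>T. b i) \<in> carrier R" if "T \<subseteq> I" for T
    using that assms by (intro finprod_closed) auto
  have "Pow I = (\<Union>j\<in>{..card I}. ?P j)"
    using assms by (auto simp: card_mono)
  then have "(\<Otimes>i\<in>I. x \<oplus> b i) = (\<Oplus>T\<in>(\<Union>j\<in>{..card I}. ?P j). ?f T)"
    using finprod_add_expand[OF assms] by simp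
  also have "\<dots> = (\<Oplus>j\<in>{..card I}. \<Oplus>T\<in>?P j. ?f T)"
    using assms bT by (intro add.finprod_UN_disjoint) (auto simp: pairwise_def disjnt_def)
  also have "\<dots> = (\<Oplus>j\<in>{..card I}. elem_sym b I j \<otimes> x [^] (card I - j))"
  proof (intro finsum_cong')
    fix j
    have "(\<Oplus>T\<in>?P j. ?f T) = (\<Oplus>T\<in>?P j. (\<Otimes>i\<in>T. b i) \<otimes> x [^] (card I - j))"
      using assms bT by (intro finsum_cong') (auto simp: card_Diff_subset finite_subset)
    also have "\<dots> = elem_sym b I j \<otimes> x [^] (card I - j)"
      unfolding elem_sym_def using assms bT by (intro finsum_ldistr[symmetric]) auto
    finally show "(\<Oplus>T\<in>?P j. ?f T) = elem_sym b I j \<otimes> x [^] (card I - j)" .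
  qed (use assms in \<open>auto simp: elem_sym_closed\<close>)
  finally show ?thesis .
qed

text \<open>Applying \<open>h\<close> relabels the family \<open>b\<close> along the permutation
  \<pi>, and \<pi> also permutes the subsets of size \<open>j\<close>. So \<open>h\<close> only
  reorders the summands.\<close>

lemma (in cring) hom_elem_sym:
  assumes "h \<in> ring_hom R R" "b \<in> I \<rightarrow> carrier R" "finite I"
    and \<pi>: "bij_betw \<pi> I I" "\<And>i. i \<in> I \<Longrightarrow> h (b i) = b (\<pi> i)"
  shows "h (elem_sym b I j) = elem_sym b I j"
proof -
  interpret h: ring_hom_cring R R h
    using assms(1) by unfold_locales
  let ?P = "{T. T \<subseteq> I \<and> card T = j}"
  have bT: "(\<Otimes>i\<in>T. b i) \<in> carrier R" if "T \<subseteq> I" for T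
    using that assms by (intro finprod_closed) auto
  have \<pi>b: "b (\<pi> i) \<in> carrier R" if "i \<in> I" for i
    using that assms(2) \<pi>(1) by (auto dest: bij_betwE)
  have inj: "inj_on \<pi> T" if "T \<subseteq> I" for T
    using \<pi>(1) that by (auto simp: bij_betw_def intro: inj_on_subset)
  have Pinj: "inj_on ((`) \<pi>) ?P"
    using \<pi>(1) by (auto simp: bij_betw_def intro!: inj_onI dest: inj_on_image_eq_iff)
  have "(`) \<pi> ` ?P \<subseteq> ?P"
    using \<pi>(1) inj by (auto simp: bij_betw_def card_image)
  with Pinj have img: "(`) \<pi> ` ?P = ?P"
    using assms(3) by (intro endo_inj_surj) auto
  have "h (elem_sym b I j) = (\<Oplus>T\<in>?P. h (\<Otimes>i\<in>T. b i))"
    unfolding elem_sym_def using bT by (simp add: Pi_iff o_def)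
  also have "\<dots> = (\<Oplus>T\<in>?P. \<Otimes>i\<in>\<pi> ` T. b i)"
  proof (intro finsum_cong')
    fix T assume T: "T \<in> ?P"
    have "h (\<Otimes>i\<in>T. b i) = (\<Otimes>i\<in>T. h (b i))"
      using T assms(2) by (subst h.hom_finprod) (auto simp: o_def)
    also have "\<dots> = (\<Otimes>i\<in>T. b (\<pi> i))"
      using T \<pi>b \<pi>(2) by (intro finprod_cong') auto
    also have "\<dots> = (\<Otimes>i\<in>\<pi> ` T. b i)"
      using T \<pi>b inj by (intro finprod_reindex[symmetric]) auto
    finally show "h (\<Otimes>i\<in>T. b i) = (\<Otimes>i\<in>\<pi> ` T. b i)" .
  qed (use \<pi>(1) bT in \<open>auto simp: bij_betw_def intro!: bT\<close>)
  also have "\<dots> = (\<Oplus>T\<in>(`) \<pi> ` ?P. \<Otimes>i\<in>T. b i)"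
    using Pinj bT img by (intro finsum_reindex[symmetric]) auto
  also have "\<dots> = elem_sym b I j"
    unfolding img elem_sym_def ..
  finally show ?thesis .
qed

section \<open>Rings generated by finitely many integral elements are finite modules\<close>

lemma (in cring) submodule_finsum:
  assumes H: "submodule H (R\<lparr>carrier := K\<rparr>) (mult_module R)"
    and f: "\<And>i. i \<in> I \<Longrightarrow> f i \<in> H"
  shows "(\<Oplus>i\<in>I. f i) \<in> H"
proof (cases "finite I")
  case True
  then show ?thesis
    using f
  proof (induction I rule: finite_induct)
    case empty
    then show ?case
      using submodule_mult_moduleE(2)[OF H] by simp
  next
    case (insert i I)
    then show ?case
      using submodule_mult_moduleE(1,3)[OF H] by (subst finsum_insert) (auto simp: Pi_iff subset_iff)
  qed
\<comment> \<open>A sum over an infinite index set is zero by convention, and zero lies in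
  \<open>H\<close>.\<close>
qed (use submodule_mult_moduleE(2)[OF H] in \<open>simp add: finsum_infinite\<close>)

text \<open>The induction principle for products with a span: by commutativity, the \<open>y\<close>
  with \<open>c y\<close> in \<open>H\<close> form a \<open>K\<close>-submodule, so checking the
  generators \<open>A\<close> suffices.\<close>

lemma (in cring) mult_module_span_mult:
  assumes K: "subring K R" and H: "submodule H (R\<lparr>carrier := K\<rparr>) (mult_module R)"
    and A: "A \<subseteq> carrier R" and c: "c \<in> carrier R" and cA: "\<And>x. x \<in> A \<Longrightarrow> c \<otimes> x \<in> H"
    and y: "y \<in> module_span (R\<lparr>carrier := K\<rparr>) (mult_module R) A"
  shows "c \<otimes> y \<in> H"
proof -
  note HE = submodule_mult_moduleE[OF H]
  have "submodule {y \<in> carrier R. c \<otimes> y \<in> H} (R\<lparr>carrier := K\<rparr>) (mult_module R)"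
  proof (rule submodule_mult_moduleI[OF _ _ _ _ K])
    fix a x assume a: "a \<in> K" and x: "x \<in> {y \<in> carrier R. c \<otimes> y \<in> H}"
    have "a \<in> carrier R"
      using a subringE(1)[OF K] by auto
    moreover have "c \<otimes> (a \<otimes> x) = a \<otimes> (c \<otimes> x)"
      using \<open>a \<in> carrier R\<close> c x by (simp add: m_lcomm)
    ultimately show "a \<otimes> x \<in> {y \<in> carrier R. c \<otimes> y \<in> H}"
      using a x HE(5) by auto
  qed (use HE c in \<open>auto simp: r_distr\<close>)
  moreover have "A \<subseteq> {y \<in> carrier R. c \<otimes> y \<in> H}"
    using A cA by auto
  ultimately show ?thesis
    using module_span_minimal y by blast
qed

text \<open>The new generators are the products \<open>f a^j\<close> with \<open>f\<close> in
  \<open>F\<close> and \<open>j < m\<close>. Integrality reduces all higher powers of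
  \<open>a\<close> to these, and since \<open>spn F\<close> is already a ring, products of the new
  generators stay in their span.\<close>

lemma (in cring) adjoin_integral:
  fixes K defines "spn \<equiv> module_span (R\<lparr>carrier := K\<rparr>) (mult_module R)"
  assumes K: "subring K R" and F: "finite F" "F \<subseteq> carrier R" and FR: "subring (spn F) R"
    and a: "a \<in> carrier R" and am: "a [^] m \<in> spn (([^]) a ` {..<m::nat})"
  shows "\<exists>F'. finite F' \<and> F' \<subseteq> carrier R \<and> subring (spn F') R \<and> insert a (spn F) \<subseteq> spn F'"
proof (intro exI conjI)
  let ?F' = "(\<lambda>(f, j). f \<otimes> a [^] j) ` (F \<times> {..<m})"
  show "finite ?F'"
    using F by auto
  show F': "?F' \<subseteq> carrier R"
    using F a by auto
  interpret M: module "R\<lparr>carrier := K\<rparr>" "mult_module R"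
    using K by (rule module_mult_module)
  have sub: "submodule (spn A) (R\<lparr>carrier := K\<rparr>) (mult_module R)" if "A \<subseteq> carrier R" for A
    unfolding spn_def by (rule M.submodule_module_span) (simp add: mult_module_def that)
  note H = sub[OF F'] and HE = submodule_mult_moduleE[OF sub[OF F']]
  note span_mult = mult_module_span_mult[OF K H, folded spn_def]
  have spanF: "F \<subseteq> spn F" "spn F \<subseteq> carrier R"
    unfolding spn_def by (rule module_span_superset) (rule subringE(1)[OF FR, unfolded spn_def])
  have pow: "f \<otimes> a [^] n \<in> spn ?F'" if f: "f \<in> F" for f and n :: nat
  proof (induction n rule: less_induct)
    case (less n)
    show ?case
    proof (cases "n < m")
      case True
      then have "f \<otimes> a [^] n \<in> ?F'"
        using f by auto
      then show ?thesis
        unfolding spn_def by (rule module_span_base)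
    next
      case False
      \<comment> \<open>By \<open>am\<close> the last factor is a \<open>K\<close>-combination of
        the \<open>a^j\<close> with \<open>j < m\<close>. Each of them leads to an exponent
        \<open>n - m + j\<close> below \<open>n\<close>, where the induction hypothesis
        applies.\<close>
      have "(f \<otimes> a [^] (n - m)) \<otimes> a [^] m \<in> spn ?F'"
      proof (rule span_mult[OF _ _ _ am])
        fix x assume "x \<in> ([^]) a ` {..<m}"
        then obtain j where j: "j < m" "x = a [^] j"
          by auto
        have "(f \<otimes> a [^] (n - m)) \<otimes> x = f \<otimes> a [^] (n - m + j)"
          using j f F a by (simp add: m_assoc nat_pow_mult subset_iff)
        moreover have "n - m + j < n"
          using False j by simp
        ultimately show "(f \<otimes> a [^] (n - m)) \<otimes> x \<in> spn ?F'"
          using less.IH by metis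
      qed (use a f F in auto)
      moreover have "(f \<otimes> a [^] (n - m)) \<otimes> a [^] m = f \<otimes> a [^] n"
        using False f F a by (simp add: m_assoc nat_pow_mult subset_iff)
      ultimately show ?thesis
        by simp
    qed
  qed
  have powF: "a [^] n \<otimes> x \<in> spn ?F'" if x: "x \<in> spn F" for x and n :: nat
  proof (rule span_mult[OF F(2) _ _ x])
    show "a [^] n \<otimes> f \<in> spn ?F'" if "f \<in> F" for f
      using pow[OF that, of n] that F a by (metis m_comm nat_pow_closed subsetD)
  qed (use a in auto)
  \<comment> \<open>On a generator, \<open>(x a^n)(f a^j) = a^(n+j) (x f)\<close>, and
    \<open>x f\<close> is in the ring \<open>spn F\<close>, so \<open>powF\<close> applies.\<close>
  have mult1: "(x \<otimes> a [^] n) \<otimes> y \<in> spn ?F'" if x: "x \<in> spn F" and y: "y \<in> spn ?F'" for x y and n :: nat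
  proof (rule span_mult[OF F' _ _ y])
    fix z assume "z \<in> ?F'"
    then obtain f and j :: nat where z: "f \<in> F" "z = f \<otimes> a [^] j"
      by auto
    have c: "x \<in> carrier R" "f \<in> carrier R" "a [^] n \<in> carrier R" "a [^] j \<in> carrier R"
      using z spanF x F a by auto
    have "(x \<otimes> a [^] n) \<otimes> z = (a [^] n \<otimes> a [^] j) \<otimes> (x \<otimes> f)"
      unfolding z using c by (simp add: m_ac)
    also have "\<dots> = a [^] (n + j) \<otimes> (x \<otimes> f)"
      using a by (simp add: nat_pow_mult)
    also have "\<dots> \<in> spn ?F'"
      using z spanF x subringE(6)[OF FR] by (intro powF) auto
    finally show "(x \<otimes> a [^] n) \<otimes> z \<in> spn ?F'" .
  qed (use a x spanF in auto)
  \<comment> \<open>Extension to the other factor: a generator \<open>w = f a^j\<close> is itself a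
    multiplier of the form allowed in \<open>mult1\<close>.\<close>
  have mult2: "y \<otimes> z \<in> spn ?F'" if y: "y \<in> spn ?F'" and z: "z \<in> spn ?F'" for y z
  proof (rule span_mult[OF F' _ _ z])
    fix w assume w: "w \<in> ?F'"
    then obtain f and j :: nat where "f \<in> F" "w = f \<otimes> a [^] j"
      by auto
    then have "w \<otimes> y \<in> spn ?F'"
      using mult1[OF _ y] spanF by auto
    then show "y \<otimes> w \<in> spn ?F'"
      using m_comm[OF subsetD[OF HE(1) y] subsetD[OF F' w]] by simp
  qed (use y HE(1) in auto)
  have sub_F': "spn F \<subseteq> spn ?F'"
  proof
    fix x assume x: "x \<in> spn F"
    then have "x \<in> carrier R"
      using spanF by auto
    then show "x \<in> spn ?F'"
      using powF[OF x, of 0] by simp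
  qed
  then have one: "\<one> \<in> spn ?F'"
    using subringE(3)[OF FR] by auto
  then show "subring (spn ?F') R"
    using HE mult2 by (intro subringI) auto
  have "a \<in> spn ?F'"
    using powF[of \<one> 1] subringE(3)[OF FR] a by simp
  with sub_F' show "insert a (spn F) \<subseteq> spn ?F'"
    by simp
qed

text \<open>Induction on \<open>A\<close>: the start is \<open>K\<close> itself, spanned by
  \<open>1\<close>, and each further element is adjoined by \<open>adjoin_integral\<close>, always
  with its integral relation over \<open>K\<close>.\<close>

lemma (in cring) ex_finite_span_integral:
  fixes K defines "spn \<equiv> module_span (R\<lparr>carrier := K\<rparr>) (mult_module R)"
  assumes K: "subring K R" and A: "finite A" "A \<subseteq> carrier R"
    and int: "\<And>a. a \<in> A \<Longrightarrow> \<exists>m. a [^] m \<in> spn (([^]) a ` {..<m::nat})"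
  shows "\<exists>F. finite F \<and> F \<subseteq> carrier R \<and> subring (spn F) R \<and> A \<subseteq> spn F"
  using A int
proof (induction A rule: finite_induct)
  case empty
  interpret M: module "R\<lparr>carrier := K\<rparr>" "mult_module R"
    using K by (rule module_mult_module)
  have "submodule (spn {\<one>}) (R\<lparr>carrier := K\<rparr>) (mult_module R)"
    unfolding spn_def by (rule M.submodule_module_span) (simp add: mult_module_def)
  note HE = submodule_mult_moduleE[OF this]
  have "submodule K (R\<lparr>carrier := K\<rparr>) (mult_module R)"
    using subringE[OF K] by (intro submodule_mult_moduleI K) auto
  then have "spn {\<one>} \<subseteq> K"
    unfolding spn_def using subringE(3)[OF K] by (intro module_span_minimal) auto
  moreover have one: "\<one> \<in> spn {\<one>}"
    unfolding spn_def by (simp add: module_span_base)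
  then have "K \<subseteq> spn {\<one>}"
    using HE(5)[OF _ one] subringE(1)[OF K] by (auto simp: subset_iff)
  ultimately have "spn {\<one>} = K"
    by blast
  then show ?case
    using K by (intro exI[of _ "{\<one>}"]) auto
next
  case (insert a A)
  then obtain F where "finite F" "F \<subseteq> carrier R" "subring (spn F) R" "A \<subseteq> spn F"
    by auto
  moreover obtain m :: nat where "a [^] m \<in> spn (([^]) a ` {..<m})"
    using insert.prems by auto
  ultimately have "\<exists>F'. finite F' \<and> F' \<subseteq> carrier R \<and> subring (spn F') R \<and> insert a (spn F) \<subseteq> spn F'"
    using insert.prems unfolding spn_def by (intro adjoin_integral K) auto
  then show ?case
    using \<open>A \<subseteq> spn F\<close> by (meson insert_subset subset_trans)
qed

section \<open>Integrality over the fixed subring\<close>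

lemma (in cring) subring_fixed:
  assumes "G \<subseteq> ring_hom R R"
  shows "subring {s \<in> carrier R. \<forall>g\<in>G. g s = s} R"
proof -
  have "subring {s \<in> carrier R. g s = s} R" if "g \<in> G" for g
  proof -
    interpret g: ring_hom_cring R R g
      using that assms by unfold_locales auto
    show ?thesis
      by (intro subringI) auto
  qed
  \<comment> \<open>The whole carrier is inserted so that the family is non-empty even for empty
    \<open>G\<close>.\<close>
  then have "subring (\<Inter>(insert (carrier R) ((\<lambda>g. {s \<in> carrier R. g s = s}) ` G))) R"
    using carrier_is_subring by (intro subring_Inter) auto
  also have "\<Inter>(insert (carrier R) ((\<lambda>g. {s \<in> carrier R. g s = s}) ` G)) =
      {s \<in> carrier R. \<forall>g\<in>G. g s = s}"
    by auto
  finally show ?thesis .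
qed

text \<open>The product of all \<open>a - g a\<close> vanishes because the identity contributes the
  factor \<open>a - a\<close>. Expanding it by \<open>finprod_add_eq_elem_sym\<close> and solving
  for the leading power gives the relation; its coefficients lie in \<open>K\<close> because
  composition with any \<open>h\<close> in \<open>G\<close> permutes \<open>G\<close>.\<close>

lemma (in cring) fixed_integral:
  fixes G :: "('a \<Rightarrow> 'a) set"
  defines "K \<equiv> {s \<in> carrier R. \<forall>g\<in>G. g s = s}"
  assumes fin: "finite G" and G: "G \<subseteq> ring_hom R R \<inter> Bij (carrier R)"
    and id: "(\<lambda>x\<in>carrier R. x) \<in> G"
    and comp: "\<And>g h. g \<in> G \<Longrightarrow> h \<in> G \<Longrightarrow> compose (carrier R) g h \<in> G"
    and a: "a \<in> carrier R"
  shows "a [^] card G \<in> module_span (R\<lparr>carrier := K\<rparr>) (mult_module R) (([^]) a ` {..<card G})"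
    (is "_ \<in> ?H")
proof -
  let ?n = "card G"
  let ?b = "\<lambda>g. \<ominus> g a"
  let ?e = "elem_sym ?b G"
  have K: "subring K R"
    unfolding K_def using G by (intro subring_fixed) auto
  interpret M: module "R\<lparr>carrier := K\<rparr>" "mult_module R"
    using K by (rule module_mult_module)
  have H: "submodule ?H (R\<lparr>carrier := K\<rparr>) (mult_module R)"
    by (rule M.submodule_module_span) (use a in \<open>auto simp: mult_module_def\<close>)
  note HE = submodule_mult_moduleE[OF H]
  have closed: "g x \<in> carrier R" if "g \<in> G" "x \<in> carrier R" for g x
    using that G by (auto intro: ring_hom_closed)
  then have b: "?b \<in> G \<rightarrow> carrier R"
    using a by auto
  have eK: "?e j \<in> K" for j
  proof -
    have "h (?e j) = ?e j" if h: "h \<in> G" for h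
    proof (rule hom_elem_sym[where \<pi> = "compose (carrier R) h"])
      interpret h: ring_hom_cring R R h
        using h G by unfold_locales auto
      have "inj_on (compose (carrier R) h) G"
      proof (rule inj_onI)
        fix f g assume fg: "f \<in> G" "g \<in> G" "compose (carrier R) h f = compose (carrier R) h g"
        show "f = g"
        \<comment> \<open>Automorphisms are extensional, so agreement on the carrier gives equality
          as functions.\<close>
        proof (rule extensionalityI[of _ "carrier R"])
          show "f \<in> extensional (carrier R)" "g \<in> extensional (carrier R)"
            using fg G by (auto simp: Bij_def)
          fix x assume x: "x \<in> carrier R"
          have "h (f x) = h (g x)"
            using fg(3) x by (metis compose_eq)
          moreover have "inj_on h (carrier R)"
            using h G by (auto simp: Bij_def bij_betw_def)
          moreover have "f x \<in> carrier R" "g x \<in> carrier R"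
            using fg x by (auto intro: closed)
          ultimately show "f x = g x"
            by (simp add: inj_on_eq_iff)
        qed
      qed
      moreover from this have "compose (carrier R) h ` G = G"
        using fin comp[OF h] by (intro endo_inj_surj) auto
      ultimately show "bij_betw (compose (carrier R) h) G G"
        by (simp add: bij_betw_def)
      show "h (?b g) = ?b (compose (carrier R) h g)" if "g \<in> G" for g
      proof -
        have "g a \<in> carrier R"
          using that a by (rule closed)
        then show ?thesis
          using a by (simp add: compose_eq)
      qed
    qed (use h G fin b in auto)
    then show ?thesis
      using elem_sym_closed[OF b] by (auto simp: K_def)
  qed
  \<comment> \<open>Starting at \<open>j = 1\<close> keeps the exponent \<open>?n - j\<close>
    strictly below \<open>?n\<close>.\<close>
  have eH: "?e j \<otimes> a [^] (?n - j) \<in> ?H" if "j \<in> {1..?n}" for j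
  proof (intro HE(5) eK)
    have "a [^] (?n - j) \<in> ([^]) a ` {..<?n}"
      using that by auto
    then show "a [^] (?n - j) \<in> ?H"
      by (rule module_span_base)
  qed
  let ?s = "\<Oplus>j\<in>{1..?n}. ?e j \<otimes> a [^] (?n - j)"
  have sH: "?s \<in> ?H"
    using eH by (rule submodule_finsum[OF H])
  let ?id = "\<lambda>x\<in>carrier R. x"
  have cl: "(\<lambda>g. a \<oplus> ?b g) \<in> G - {?id} \<rightarrow> carrier R"
    using a closed by blast
  have "a \<oplus> ?b ?id = \<zero>"
    using a by (simp add: r_neg)
  then have "(\<Otimes>g\<in>insert ?id (G - {?id}). a \<oplus> ?b g) = \<zero> \<otimes> (\<Otimes>g\<in>G - {?id}. a \<oplus> ?b g)"
    using fin cl by (subst finprod_insert) (simp_all del: restrict_apply)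
  also have "\<dots> = \<zero>"
    using cl by (intro l_null finprod_closed)
  also have "insert ?id (G - {?id}) = G"
    using id by blast
  finally have "\<zero> = (\<Otimes>g\<in>G. a \<oplus> ?b g)" ..
  also have "\<dots> = (\<Oplus>j\<in>{..?n}. ?e j \<otimes> a [^] (?n - j))"
    by (rule finprod_add_eq_elem_sym[OF fin a b])
  \<comment> \<open>The term for \<open>j = 0\<close> is split off; it is \<open>a^?n\<close>, since
    \<open>elem_sym\<close> at 0 is \<open>1\<close>.\<close>
  also have "{..?n} = insert 0 {1..?n}"
    by auto
  also have "(\<Oplus>j\<in>insert 0 {1..?n}. ?e j \<otimes> a [^] (?n - j)) = a [^] ?n \<oplus> ?s"
    using a b fin by (subst finsum_insert) (auto simp: elem_sym_closed elem_sym_0)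
  finally have "a [^] ?n \<oplus> ?s = \<zero>" ..
  moreover have "?s \<in> carrier R"
    using sH HE(1) by (rule subsetD[rotated])
  ultimately have "\<ominus> ?s = a [^] ?n"
    using a by (intro minus_equality nat_pow_closed)
  then show ?thesis
    using HE(4)[OF sH] by metis
qed

section \<open>Quotient modules\<close>

text \<open>The scalar action on a coset is a union over all its representatives. Two of them differ
  by some \<open>n\<close> in \<open>N\<close>, and \<open>a n\<close> is again in \<open>N\<close>,
  so all members of this non-empty union are the same coset.\<close>

lemma (in module) smult_quotient_module:
  assumes N: "submodule N R M" and a: "a \<in> carrier R" and x: "x \<in> carrier M"
  shows "a \<odot>\<^bsub>quotient_module M N\<^esub> (N +>\<^bsub>M\<^esub> x) = N +>\<^bsub>M\<^esub> (a \<odot>\<^bsub>M\<^esub> x)"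
proof -
  note NE = submoduleE[OF N] and NS = submodule.axioms(1)[OF N]
  have "N +>\<^bsub>M\<^esub> (a \<odot>\<^bsub>M\<^esub> y) = N +>\<^bsub>M\<^esub> (a \<odot>\<^bsub>M\<^esub> x)" if y: "y \<in> N +>\<^bsub>M\<^esub> x" for y
  proof -
    obtain n where n: "n \<in> N" "y = n \<oplus>\<^bsub>M\<^esub> x"
      using y by (auto simp: a_r_coset_def')
    have "a \<odot>\<^bsub>M\<^esub> y = a \<odot>\<^bsub>M\<^esub> n \<oplus>\<^bsub>M\<^esub> a \<odot>\<^bsub>M\<^esub> x"
      using n NE(1) a x by (simp add: smult_r_distr subset_iff)
    moreover have "a \<odot>\<^bsub>M\<^esub> n \<in> N"
      using NE(4) a n by simp
    ultimately have "a \<odot>\<^bsub>M\<^esub> y \<in> N +>\<^bsub>M\<^esub> (a \<odot>\<^bsub>M\<^esub> x)"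
      by (auto simp: a_r_coset_def')
    then show ?thesis
      using a x NS by (intro M.a_repr_independence[symmetric]) auto
  qed
  moreover have "N +>\<^bsub>M\<^esub> x \<noteq> {}"
    using NE(2) by (auto simp: a_r_coset_def')
  ultimately show ?thesis
    by (auto simp: quotient_module_def)
qed

lemma (in module) module_quotient_module:
  assumes N: "submodule N R M"
  shows "module R (quotient_module M N)"
proof -
  interpret N: abelian_subgroup N M
    using submodule.axioms(1)[OF N]
    by (intro abelian_subgroupI3 additive_subgroupI M.abelian_group_axioms)
  let ?Q = "quotient_module M N"
  have carr: "C \<in> carrier ?Q \<longleftrightarrow> (\<exists>x\<in>carrier M. C = N +>\<^bsub>M\<^esub> x)" for C
    by (auto simp: quotient_module_def A_RCOSETS_def')
  \<comment> \<open>Written as the coset of zero, the neutral element falls under \<open>add\<close>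
    like every other coset.\<close>
  have zero: "\<zero>\<^bsub>?Q\<^esub> = N +>\<^bsub>M\<^esub> \<zero>\<^bsub>M\<^esub>"
    using N.a_subset by (simp add: quotient_module_def)
  have add: "(N +>\<^bsub>M\<^esub> x) \<oplus>\<^bsub>?Q\<^esub> (N +>\<^bsub>M\<^esub> y) = N +>\<^bsub>M\<^esub> (x \<oplus>\<^bsub>M\<^esub> y)"
    if "x \<in> carrier M" "y \<in> carrier M" for x y
    using that N.a_rcos_sum by (simp add: quotient_module_def)
  note smult = smult_quotient_module[OF N]
  have ag: "abelian_group ?Q"
  proof (rule abelian_groupI)
    fix C assume "C \<in> carrier ?Q"
    then obtain x where x: "x \<in> carrier M" "C = N +>\<^bsub>M\<^esub> x"
      by (auto simp: carr)
    then have "(N +>\<^bsub>M\<^esub> (\<ominus>\<^bsub>M\<^esub> x)) \<oplus>\<^bsub>?Q\<^esub> C = \<zero>\<^bsub>?Q\<^esub>"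
      by (simp add: add zero M.l_neg)
    moreover have "N +>\<^bsub>M\<^esub> (\<ominus>\<^bsub>M\<^esub> x) \<in> carrier ?Q"
      using x M.a_inv_closed unfolding carr by blast
    ultimately show "\<exists>D\<in>carrier ?Q. D \<oplus>\<^bsub>?Q\<^esub> C = \<zero>\<^bsub>?Q\<^esub>" ..
  qed (auto simp: carr add zero M.a_ac simp del: M.a_coset_add_zero)
  show ?thesis
    by (rule moduleI[OF R.is_cring ag])
      (auto simp: carr add smult smult_l_distr smult_r_distr smult_assoc1)
qed

text \<open>The cosets of a finite generating set generate: the preimage of their span under the
  projection is a submodule of \<open>M\<close> containing the generators, hence all of
  \<open>M\<close>.\<close>

lemma (in module) fin_gen_quotient_module:
  assumes N: "submodule N R M" and M: "fin_gen_module R M"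
  shows "fin_gen_module R (quotient_module M N)"
proof -
  interpret N: abelian_subgroup N M
    using submodule.axioms(1)[OF N]
    by (intro abelian_subgroupI3 additive_subgroupI M.abelian_group_axioms)
  let ?Q = "quotient_module M N"
  interpret Q: module R ?Q
    using N by (rule module_quotient_module)
  obtain F where F: "finite F" "F \<subseteq> carrier M" "module_span R M F = carrier M"
    using M by (auto simp: fin_gen_module_def)
  have carr: "carrier ?Q = (\<lambda>x. N +>\<^bsub>M\<^esub> x) ` carrier M"
    by (auto simp: quotient_module_def A_RCOSETS_def')
  let ?F = "(\<lambda>x. N +>\<^bsub>M\<^esub> x) ` F"
  let ?H = "module_span R ?Q ?F"
  have F': "?F \<subseteq> carrier ?Q"
    using F by (auto simp: carr)
  have H: "submodule ?H R ?Q"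
    using F' by (rule Q.submodule_module_span)
  note HE = Q.submoduleE[OF H]
  have add: "(N +>\<^bsub>M\<^esub> x) \<oplus>\<^bsub>?Q\<^esub> (N +>\<^bsub>M\<^esub> y) = N +>\<^bsub>M\<^esub> (x \<oplus>\<^bsub>M\<^esub> y)"
    if "x \<in> carrier M" "y \<in> carrier M" for x y
    using that N.a_rcos_sum by (simp add: quotient_module_def)
  note smult = smult_quotient_module[OF N, symmetric]
  have "submodule {x \<in> carrier M. N +>\<^bsub>M\<^esub> x \<in> ?H} R M"
  proof (rule submoduleI)
    have "N \<in> ?H"
      using subgroup.one_closed[OF submodule.axioms(1)[OF H]] by (simp add: quotient_module_def)
    then show "\<zero>\<^bsub>M\<^esub> \<in> {x \<in> carrier M. N +>\<^bsub>M\<^esub> x \<in> ?H}"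
      using N.a_subset by simp
    show "\<ominus>\<^bsub>M\<^esub> x \<in> {x \<in> carrier M. N +>\<^bsub>M\<^esub> x \<in> ?H}"
      if x: "x \<in> {x \<in> carrier M. N +>\<^bsub>M\<^esub> x \<in> ?H}" for x
    proof -
      \<comment> \<open>As multiplication by the scalar \<open>-1\<close>, negation passes to cosets
        through \<open>smult\<close>.\<close>
      have "\<ominus>\<^bsub>M\<^esub> x = (\<ominus> \<one>) \<odot>\<^bsub>M\<^esub> x"
        using x by (simp add: smult_l_minus)
      then show ?thesis
        using x HE(4)[of "\<ominus> \<one>"] by (simp add: smult)
    qed
  qed (use HE in \<open>auto simp: smult add[symmetric]\<close>)
  then have "module_span R M F \<subseteq> {x \<in> carrier M. N +>\<^bsub>M\<^esub> x \<in> ?H}"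
    using F by (intro module_span_minimal) (auto intro: module_span_base)
  then have "carrier ?Q \<subseteq> ?H"
    using F by (auto simp: carr)
  then have "?H = carrier ?Q"
    using HE(1) by blast
  then show ?thesis
    unfolding fin_gen_module_def using F F' Q.module_axioms by blast
qed

section \<open>The cofixed kernel and finite generation over the fixed subalgebra\<close>

text \<open>The scalars change from the base ring to the fixed elements. If \<open>a\<close> is
  fixed, then \<open>a (g s - s) = g (a s) - a s\<close>, so multiplication by \<open>a\<close> maps
  generators of the kernel to generators.\<close>

lemma (in algebra) submodule_cofixed_kernel:
  assumes G: "G \<subseteq> alg_auto R M"
  shows "submodule (cofixed_kernel R M G) (fixed_subalgebra M G) (mult_module M)"
proof -
  let ?gen = "{g s \<ominus>\<^bsub>M\<^esub> s | g s. g \<in> G \<and> s \<in> carrier M}"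
  let ?N = "cofixed_kernel R M G"
  have hom: "ring_hom_cring M M g" if "g \<in> G" for g
    using that G by (intro ring_hom_cring.intro ring_hom_cring_axioms.intro M_cring) (auto simp: alg_auto_def)
  have gen: "?gen \<subseteq> carrier M"
    using hom[THEN ring_hom_cring.axioms(3)] by (auto simp: ring_hom_cring_axioms_def dest: ring_hom_closed)
  have N: "submodule ?N R M"
    unfolding cofixed_kernel_def using gen by (rule submodule_module_span)
  note NE = submoduleE[OF N]
  have mult: "a \<otimes>\<^bsub>M\<^esub> x \<in> ?N" if a: "a \<in> carrier M" "\<And>g. g \<in> G \<Longrightarrow> g a = a" and x: "x \<in> ?N" for a x
  proof -
    have sm: "a \<otimes>\<^bsub>M\<^esub> (c \<odot>\<^bsub>M\<^esub> x) = c \<odot>\<^bsub>M\<^esub> (a \<otimes>\<^bsub>M\<^esub> x)" if "c \<in> carrier R" "x \<in> carrier M" for c x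
      using that a by (metis m_comm smult_assoc2 smult_closed)
    \<comment> \<open>Multiplication by \<open>a\<close> is linear over \<open>R\<close>, so the
      preimage of the kernel is a submodule over \<open>R\<close> and can be compared with the
      span.\<close>
    have "submodule {x \<in> carrier M. a \<otimes>\<^bsub>M\<^esub> x \<in> ?N} R M"
      using a NE subgroup.one_closed[OF submodule.axioms(1)[OF N]]
      by (intro submoduleI) (auto simp: sm r_distr r_minus)
    moreover have "?gen \<subseteq> {x \<in> carrier M. a \<otimes>\<^bsub>M\<^esub> x \<in> ?N}"
    proof clarify
      fix g s assume gs: "g \<in> G" "s \<in> carrier M"
      interpret g: ring_hom_cring M M g
        using gs hom by auto
      have "a \<otimes>\<^bsub>M\<^esub> (g s \<ominus>\<^bsub>M\<^esub> s) = g (a \<otimes>\<^bsub>M\<^esub> s) \<ominus>\<^bsub>M\<^esub> (a \<otimes>\<^bsub>M\<^esub> s)"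
        using a(1) a(2)[OF gs(1)] gs by (simp add: M.minus_eq r_distr r_minus)
      then have "a \<otimes>\<^bsub>M\<^esub> (g s \<ominus>\<^bsub>M\<^esub> s) \<in> ?gen"
        using a gs by blast
      then have "a \<otimes>\<^bsub>M\<^esub> (g s \<ominus>\<^bsub>M\<^esub> s) \<in> ?N"
        unfolding cofixed_kernel_def by (rule module_span_base)
      then show "g s \<ominus>\<^bsub>M\<^esub> s \<in> carrier M \<and> a \<otimes>\<^bsub>M\<^esub> (g s \<ominus>\<^bsub>M\<^esub> s) \<in> ?N"
        using gs by simp
    qed
    ultimately show ?thesis
      using x module_span_minimal unfolding cofixed_kernel_def by blast
  qed
  then show ?thesis
    unfolding fixed_subalgebra_def submodule_mult_module_iff
    using submodule.axioms(1)[OF N] by auto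
qed

text \<open>The algebra generators \<open>A\<close> are integral over the fixed subring
  \<open>K\<close>, so they lie in a subring that is the \<open>K\<close>-span of a finite set
  \<open>F\<close>. This subring is also stable under \<open>R\<close>, hence a subalgebra
  containing \<open>A\<close>, hence everything.\<close>

lemma (in algebra) fin_gen_over_fixed_subalgebra:
  assumes fg: "fin_gen_algebra R M" and G: "subgroup G (AlgAutoGroup R M)" and fin: "finite G"
  shows "fin_gen_module (fixed_subalgebra M G) (mult_module M)"
proof -
  define K where "K = {s \<in> carrier M. \<forall>g\<in>G. g s = s}"
  have aut: "G \<subseteq> alg_auto R M"
    using subgroup.subset[OF G] by (simp add: AlgAutoGroup_def)
  then have GB: "G \<subseteq> ring_hom M M \<inter> Bij (carrier M)"
    by (auto simp: alg_auto_def)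
  have id: "(\<lambda>x\<in>carrier M. x) \<in> G"
    using subgroup.one_closed[OF G] by (simp add: AlgAutoGroup_def BijGroup_def)
  have comp: "compose (carrier M) g h \<in> G" if "g \<in> G" "h \<in> G" for g h
  proof -
    have "g \<in> Bij (carrier M)" "h \<in> Bij (carrier M)"
      using GB that by auto
    then show ?thesis
      using subgroup.m_closed[OF G that] by (simp add: AlgAutoGroup_def BijGroup_def)
  qed
  have K: "subring K M"
    unfolding K_def using GB by (intro subring_fixed) auto
  interpret MM: module "M\<lparr>carrier := K\<rparr>" "mult_module M"
    using K by (rule module_mult_module)
  let ?span = "module_span (M\<lparr>carrier := K\<rparr>) (mult_module M)"
  obtain A where A: "finite A" "A \<subseteq> carrier M" "alg_span R M A = carrier M"
    using fg by (auto simp: fin_gen_algebra_def)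
  have "\<exists>m. a [^]\<^bsub>M\<^esub> m \<in> ?span (([^]\<^bsub>M\<^esub>) a ` {..<m::nat})" if "a \<in> A" for a
    unfolding K_def using that A fixed_integral[OF fin GB id comp] by blast
  from ex_finite_span_integral[OF K A(1,2) this] obtain F
    where F: "finite F" "F \<subseteq> carrier M" "subring (?span F) M" "A \<subseteq> ?span F"
    by auto
  have sub: "submodule (?span F) (M\<lparr>carrier := K\<rparr>) (mult_module M)"
    by (rule MM.submodule_module_span) (use F in \<open>simp add: mult_module_def\<close>)
  have "submodule (?span F) R M"
  proof (rule submoduleI)
    fix c x assume c: "c \<in> carrier R" and x: "x \<in> ?span F"
    \<comment> \<open>The scalars from \<open>R\<close> act through the multiples of
      \<open>1\<close>, which every algebra automorphism fixes; so stability under \<open>K\<close>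
      gives stability under \<open>R\<close>.\<close>
    have "g (c \<odot>\<^bsub>M\<^esub> \<one>\<^bsub>M\<^esub>) = c \<odot>\<^bsub>M\<^esub> \<one>\<^bsub>M\<^esub>" if "g \<in> G" for g
      using aut c that by (auto simp: alg_auto_def ring_hom_one subset_iff)
    then have "c \<odot>\<^bsub>M\<^esub> \<one>\<^bsub>M\<^esub> \<in> K"
      using c by (simp add: K_def)
    then have "(c \<odot>\<^bsub>M\<^esub> \<one>\<^bsub>M\<^esub>) \<otimes>\<^bsub>M\<^esub> x \<in> ?span F"
      using submodule_mult_moduleE(5)[OF sub] x by blast
    then show "c \<odot>\<^bsub>M\<^esub> x \<in> ?span F"
      using c x subringE(1)[OF F(3)] by (simp add: smult_assoc2 subset_iff)
  qed (use subringE[OF F(3)] in auto)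
  then have "alg_span R M A \<subseteq> ?span F"
    unfolding alg_span_def using F by (intro hull_minimal) auto
  then have "?span F = carrier (mult_module M)"
    using A subringE(1)[OF F(3)] by (auto simp: mult_module_def)
  then show ?thesis
    unfolding fin_gen_module_def fixed_subalgebra_def K_def[symmetric]
    using MM.module_axioms F by (auto simp: mult_module_def)
qed

theorem corollary5p2:
  fixes k :: "('a, 'm) ring_scheme"
    and S :: "('a, 'b, 'n) module_scheme"
    and G :: "('b \<Rightarrow> 'b) set"
  assumes "field k"
    and "fin_gen_algebra k S"
    and "subgroup G (AlgAutoGroup k S)"
    and "finite G"
  shows "fin_gen_module (fixed_subalgebra S G) (cofixed_space k S G)"
proof -
  interpret algebra k S
    using assms(2) by (simp add: fin_gen_algebra_def)
  have "G \<subseteq> alg_auto k S"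
    using subgroup.subset[OF assms(3)] by (simp add: AlgAutoGroup_def)
  then have N: "submodule (cofixed_kernel k S G) (fixed_subalgebra S G) (mult_module S)"
    by (rule submodule_cofixed_kernel)
  have fg: "fin_gen_module (fixed_subalgebra S G) (mult_module S)"
    using assms by (intro fin_gen_over_fixed_subalgebra)
  then have "module (fixed_subalgebra S G) (mult_module S)"
    by (simp add: fin_gen_module_def)
  from module.fin_gen_quotient_module[OF this N fg] show ?thesis
    unfolding cofixed_space_def .
qed

end
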